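(* Any $EMV$-algebra can be embedded into an $MV$-algebra; that is, for every $EMV$-algebra $M$ there exist an $MV$-algebra $N$ and an injective $EMV$-homomorphism $M\to N$.
   Context: An algebra $(M;\vee,\wedge,\oplus,0)$ of type $(2,2,2,0)$ is an $EMV$-algebra if: (1) $(M;\vee,\wedge,0)$ is a distributive lattice with least element $0$; (2) $(M;\oplus,0)$ is a commutative ordered monoid with neutral element $0$; (3) writing $\mathcal I(M)=\{a\in M: a\oplus a=a\}$, for all $a\le b$ in $\mathcal I(M)$ and all $x\in[a,b]$ the element $\lambda_{a,b}(x)=\min\{z\in[a,b]: x\oplus z=b\}$ exists in $M$, and $([a,b];\oplus,\lambda_{a,b},a,b)$ is an $MV$-algebra; (4) each $x\in M$ lies below some $a\in\mathcal I(M)$. We write $\lambda_b:=\lambda_{0,b}$. Every $MV$-algebra is regarded as an $EMV$-algebra with its lattice operations, $\oplus$ and $0$. An $EMV$-homomorphism is a map $f$ preserving $\vee,\wedge,\oplus,0$ with $f(\lambda_b(x))=\lambda_{f(b)}(f(x))$ for all idempotents $b$ and $x\in[0,b]$. *)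

theory Defs
  imports "HOL-Algebra.Group"
begin

record 'a oplus_struct = "'a partial_object" +
  oplus :: "'a \<Rightarrow> 'a \<Rightarrow> 'a"
  zero :: 'a

definition oplus_monoid :: "('a, 'b) oplus_struct_scheme \<Rightarrow> 'a monoid" where
  "oplus_monoid M = \<lparr>carrier = carrier M, monoid.mult = oplus M, one = zero M\<rparr>"

record 'a mv_struct = "'a oplus_struct" +
  neg :: "'a \<Rightarrow> 'a"
  unit :: 'a

text \<open>The axiom \<open>neg_zero\<close> is not redundant: the two-element join-semilattice with
  greatest element \<open>1\<close> and the identity as negation satisfies all the others.\<close>

locale mv_algebra =
  fixes N :: "'a mv_struct"
  assumes comm_monoid: "comm_monoid (oplus_monoid N)"
    and neg_closed: "x \<in> carrier N \<Longrightarrow> neg N x \<in> carrier N"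
    and unit_closed: "unit N \<in> carrier N"
    and neg_neg: "x \<in> carrier N \<Longrightarrow> neg N (neg N x) = x"
    and neg_zero: "neg N (zero N) = unit N"
    and oplus_unit: "x \<in> carrier N \<Longrightarrow> oplus N x (unit N) = unit N"
    and lukasiewicz: "\<lbrakk>x \<in> carrier N; y \<in> carrier N\<rbrakk> \<Longrightarrow>
      oplus N (neg N (oplus N (neg N x) y)) y = oplus N (neg N (oplus N (neg N y) x)) x"

record 'a emv_struct = "'a oplus_struct" +
  ejoin :: "'a \<Rightarrow> 'a \<Rightarrow> 'a"
  emeet :: "'a \<Rightarrow> 'a \<Rightarrow> 'a"

definition emv_le :: "'a emv_struct \<Rightarrow> 'a \<Rightarrow> 'a \<Rightarrow> bool" where
  "emv_le M x y \<longleftrightarrow> emeet M x y = x"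

definition idempotents :: "'a emv_struct \<Rightarrow> 'a set" where
  "idempotents M = {a \<in> carrier M. oplus M a a = a}"

definition emv_interval :: "'a emv_struct \<Rightarrow> 'a \<Rightarrow> 'a \<Rightarrow> 'a set" where
  "emv_interval M a b = {x \<in> carrier M. emv_le M a x \<and> emv_le M x b}"

definition is_emv_min :: "'a emv_struct \<Rightarrow> 'a set \<Rightarrow> 'a \<Rightarrow> bool" where
  "is_emv_min M S z \<longleftrightarrow> z \<in> S \<and> (\<forall>w\<in>S. emv_le M z w)"

definition emv_complements :: "'a emv_struct \<Rightarrow> 'a \<Rightarrow> 'a \<Rightarrow> 'a \<Rightarrow> 'a set" where
  "emv_complements M a b x = {z \<in> emv_interval M a b. oplus M x z = b}"

definition emv_lambda :: "'a emv_struct \<Rightarrow> 'a \<Rightarrow> 'a \<Rightarrow> 'a \<Rightarrow> 'a" where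
  "emv_lambda M a b x = (THE z. is_emv_min M (emv_complements M a b x) z)"

definition interval_mv :: "'a emv_struct \<Rightarrow> 'a \<Rightarrow> 'a \<Rightarrow> 'a mv_struct" where
  "interval_mv M a b =
    \<lparr>carrier = emv_interval M a b, oplus = oplus M, zero = a, neg = emv_lambda M a b, unit = b\<rparr>"

locale emv_algebra =
  fixes M :: "'a emv_struct"
  assumes join_closed: "\<lbrakk>x \<in> carrier M; y \<in> carrier M\<rbrakk> \<Longrightarrow> ejoin M x y \<in> carrier M"
    and meet_closed: "\<lbrakk>x \<in> carrier M; y \<in> carrier M\<rbrakk> \<Longrightarrow> emeet M x y \<in> carrier M"
    and join_comm: "\<lbrakk>x \<in> carrier M; y \<in> carrier M\<rbrakk> \<Longrightarrow> ejoin M x y = ejoin M y x"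
    and meet_comm: "\<lbrakk>x \<in> carrier M; y \<in> carrier M\<rbrakk> \<Longrightarrow> emeet M x y = emeet M y x"
    and join_assoc: "\<lbrakk>x \<in> carrier M; y \<in> carrier M; z \<in> carrier M\<rbrakk> \<Longrightarrow>
      ejoin M (ejoin M x y) z = ejoin M x (ejoin M y z)"
    and meet_assoc: "\<lbrakk>x \<in> carrier M; y \<in> carrier M; z \<in> carrier M\<rbrakk> \<Longrightarrow>
      emeet M (emeet M x y) z = emeet M x (emeet M y z)"
    and join_absorb: "\<lbrakk>x \<in> carrier M; y \<in> carrier M\<rbrakk> \<Longrightarrow> ejoin M x (emeet M x y) = x"
    and meet_absorb: "\<lbrakk>x \<in> carrier M; y \<in> carrier M\<rbrakk> \<Longrightarrow> emeet M x (ejoin M x y) = x"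
    and distrib: "\<lbrakk>x \<in> carrier M; y \<in> carrier M; z \<in> carrier M\<rbrakk> \<Longrightarrow>
      emeet M x (ejoin M y z) = ejoin M (emeet M x y) (emeet M x z)"
    and zero_least: "x \<in> carrier M \<Longrightarrow> emv_le M (zero M) x"
    and comm_monoid: "comm_monoid (oplus_monoid M)"
    and oplus_mono: "\<lbrakk>x \<in> carrier M; y \<in> carrier M; z \<in> carrier M; emv_le M x y\<rbrakk> \<Longrightarrow>
      emv_le M (oplus M x z) (oplus M y z)"
    and complement_exists:
      "\<lbrakk>a \<in> idempotents M; b \<in> idempotents M; emv_le M a b; x \<in> emv_interval M a b\<rbrakk> \<Longrightarrow>
      \<exists>z. is_emv_min M (emv_complements M a b x) z"
    and interval_mv_algebra:
      "\<lbrakk>a \<in> idempotents M; b \<in> idempotents M; emv_le M a b\<rbrakk> \<Longrightarrow> mv_algebra (interval_mv M a b)"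
    and idempotent_above: "x \<in> carrier M \<Longrightarrow> \<exists>a\<in>idempotents M. emv_le M x a"

text \<open>The lattice operations of an MV-algebra are \<open>x \<or> y = (x' \<oplus> y)' \<oplus> y\<close> and
  \<open>x \<and> y = (x' \<or> y')'\<close>.\<close>

definition mv_join :: "'a mv_struct \<Rightarrow> 'a \<Rightarrow> 'a \<Rightarrow> 'a" where
  "mv_join N x y = oplus N (neg N (oplus N (neg N x) y)) y"

definition mv_meet :: "'a mv_struct \<Rightarrow> 'a \<Rightarrow> 'a \<Rightarrow> 'a" where
  "mv_meet N x y = neg N (mv_join N (neg N x) (neg N y))"

definition mv_to_emv :: "'a mv_struct \<Rightarrow> 'a emv_struct" where
  "mv_to_emv N =
    \<lparr>carrier = carrier N, oplus = oplus N, zero = zero N, ejoin = mv_join N, emeet = mv_meet N\<rparr>"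

definition emv_hom :: "'a emv_struct \<Rightarrow> 'b emv_struct \<Rightarrow> ('a \<Rightarrow> 'b) set" where
  "emv_hom M N = {f. f \<in> carrier M \<rightarrow> carrier N
    \<and> (\<forall>x\<in>carrier M. \<forall>y\<in>carrier M. f (ejoin M x y) = ejoin N (f x) (f y))
    \<and> (\<forall>x\<in>carrier M. \<forall>y\<in>carrier M. f (emeet M x y) = emeet N (f x) (f y))
    \<and> (\<forall>x\<in>carrier M. \<forall>y\<in>carrier M. f (oplus M x y) = oplus N (f x) (f y))
    \<and> f (zero M) = zero N
    \<and> (\<forall>b\<in>idempotents M. \<forall>x\<in>emv_interval M (zero M) b.
        f (emv_lambda M (zero M) b x) = emv_lambda N (zero N) (f b) (f x))}"

end

theory Submission imports Defs begin

text \<open>For an idempotent \<open>b\<close> the map \<open>x \<mapsto> x \<and> b\<close> is a homomorphism from \<open>M\<close> onto the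
  MV-algebra \<open>[0, b]\<close>: distributing \<open>\<oplus>\<close> over \<open>\<and>\<close> in a large interval gives
  \<open>(x \<and> b) \<oplus> (y \<and> b) = (x \<oplus> y) \<and> (x \<oplus> b) \<and> (b \<oplus> y) \<and> b = (x \<oplus> y) \<and> b\<close>. Since every
  pair of elements lies below a common idempotent, these maps jointly embed \<open>M\<close> into the product of
  the MV-algebras \<open>[0, b]\<close> over all idempotents \<open>b\<close>.\<close>

section \<open>Elementary laws of MV-algebras\<close>

lemma oplus_monoid_simps [simp]:
  "carrier (oplus_monoid M) = carrier M" "monoid.mult (oplus_monoid M) = oplus M"
  "one (oplus_monoid M) = zero M"
  by (simp_all add: oplus_monoid_def)

lemma comm_monoid_oplus_monoidI:
  assumes "\<And>x y. \<lbrakk>x \<in> carrier M; y \<in> carrier M\<rbrakk> \<Longrightarrow> oplus M x y \<in> carrier M"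
    and "zero M \<in> carrier M"
    and "\<And>x y z. \<lbrakk>x \<in> carrier M; y \<in> carrier M; z \<in> carrier M\<rbrakk> \<Longrightarrow>
      oplus M (oplus M x y) z = oplus M x (oplus M y z)"
    and "\<And>x y. \<lbrakk>x \<in> carrier M; y \<in> carrier M\<rbrakk> \<Longrightarrow> oplus M x y = oplus M y x"
    and "\<And>x. x \<in> carrier M \<Longrightarrow> oplus M (zero M) x = x"
  shows "comm_monoid (oplus_monoid M)"
  by (rule comm_monoidI) (use assms in auto)

context mv_algebra
begin

lemma oplus_closed: "\<lbrakk>x \<in> carrier N; y \<in> carrier N\<rbrakk> \<Longrightarrow> oplus N x y \<in> carrier N"
  and zero_closed: "zero N \<in> carrier N"
  and oplus_assoc: "\<lbrakk>x \<in> carrier N; y \<in> carrier N; z \<in> carrier N\<rbrakk> \<Longrightarrow>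
    oplus N (oplus N x y) z = oplus N x (oplus N y z)"
  and oplus_comm: "\<lbrakk>x \<in> carrier N; y \<in> carrier N\<rbrakk> \<Longrightarrow> oplus N x y = oplus N y x"
  and zero_oplus: "x \<in> carrier N \<Longrightarrow> oplus N (zero N) x = x"
proof -
  interpret C: comm_monoid "oplus_monoid N" by (rule comm_monoid)
  show "\<lbrakk>x \<in> carrier N; y \<in> carrier N\<rbrakk> \<Longrightarrow> oplus N x y \<in> carrier N" "zero N \<in> carrier N"
    "\<lbrakk>x \<in> carrier N; y \<in> carrier N; z \<in> carrier N\<rbrakk> \<Longrightarrow>
      oplus N (oplus N x y) z = oplus N x (oplus N y z)"
    "\<lbrakk>x \<in> carrier N; y \<in> carrier N\<rbrakk> \<Longrightarrow> oplus N x y = oplus N y x"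
    "x \<in> carrier N \<Longrightarrow> oplus N (zero N) x = x"
    using C.m_closed C.one_closed C.m_assoc C.m_comm C.l_one by auto
qed

lemma neg_unit: "neg N (unit N) = zero N"
  using neg_neg[OF zero_closed] by (simp add: neg_zero)

end

section \<open>Products of MV-algebras\<close>

text \<open>Tuples are extensional functions: all operations yield \<open>undefined\<close> outside
  \<open>I\<close>, so elements of the carrier that agree on \<open>I\<close> are equal as HOL
  functions.\<close>

definition mv_prod :: "'i set \<Rightarrow> ('i \<Rightarrow> 'a mv_struct) \<Rightarrow> ('i \<Rightarrow> 'a) mv_struct" where
  "mv_prod I A = \<lparr>carrier = (\<Pi>\<^sub>E i\<in>I. carrier (A i)),
    oplus = (\<lambda>g h. \<lambda>i\<in>I. oplus (A i) (g i) (h i)), zero = (\<lambda>i\<in>I. zero (A i)),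
    neg = (\<lambda>g. \<lambda>i\<in>I. neg (A i) (g i)), unit = (\<lambda>i\<in>I. unit (A i))\<rparr>"

lemma mv_prod_simps:
  "carrier (mv_prod I A) = (\<Pi>\<^sub>E i\<in>I. carrier (A i))"
  "oplus (mv_prod I A) g h = (\<lambda>i\<in>I. oplus (A i) (g i) (h i))"
  "zero (mv_prod I A) = (\<lambda>i\<in>I. zero (A i))"
  "neg (mv_prod I A) g = (\<lambda>i\<in>I. neg (A i) (g i))"
  "unit (mv_prod I A) = (\<lambda>i\<in>I. unit (A i))"
  by (simp_all add: mv_prod_def)

lemma mv_join_prod: "mv_join (mv_prod I A) g h = (\<lambda>i\<in>I. mv_join (A i) (g i) (h i))"
  by (auto simp: mv_join_def mv_prod_simps fun_eq_iff)

lemma mv_meet_prod: "mv_meet (mv_prod I A) g h = (\<lambda>i\<in>I. mv_meet (A i) (g i) (h i))"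
  by (auto simp: mv_meet_def mv_join_prod mv_prod_simps mv_join_def fun_eq_iff)

lemma mv_algebra_prod:
  assumes "\<And>i. i \<in> I \<Longrightarrow> mv_algebra (A i)"
  shows "mv_algebra (mv_prod I A)"
proof -
  have mem: "g i \<in> carrier (A i)" if "g \<in> (\<Pi>\<^sub>E i\<in>I. carrier (A i))" "i \<in> I" for g i
    using that by (auto simp: PiE_iff)
  \<comment> \<open>This settles the laws whose right side is a bare tuple \<open>g\<close>, such as
    neutrality of zero and double negation; there extensionality of \<open>g\<close> is
    essential.\<close>
  have eq: "(\<lambda>i\<in>I. F i) = g" if "g \<in> (\<Pi>\<^sub>E i\<in>I. carrier (A i))" "\<And>i. i \<in> I \<Longrightarrow> F i = g i" for F g
    using that by (auto simp: PiE_iff fun_eq_iff extensional_def)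
  show ?thesis
  proof (rule mv_algebra.intro)
    show "comm_monoid (oplus_monoid (mv_prod I A))"
      by (rule comm_monoid_oplus_monoidI)
        (auto simp: mv_prod_simps mem intro!: eq restrict_ext
          mv_algebra.oplus_closed[OF assms] mv_algebra.zero_closed[OF assms]
          mv_algebra.oplus_assoc[OF assms] mv_algebra.oplus_comm[OF assms]
          mv_algebra.zero_oplus[OF assms])
  next
    fix g h assume "g \<in> carrier (mv_prod I A)" "h \<in> carrier (mv_prod I A)"
    then show
      "oplus (mv_prod I A) (neg (mv_prod I A) (oplus (mv_prod I A) (neg (mv_prod I A) g) h)) h =
       oplus (mv_prod I A) (neg (mv_prod I A) (oplus (mv_prod I A) (neg (mv_prod I A) h) g)) g"
      by (auto simp: mv_prod_simps mem intro!: restrict_ext mv_algebra.lukasiewicz[OF assms])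
  qed (auto simp: mv_prod_simps mem intro!: eq restrict_ext
      mv_algebra.neg_closed[OF assms] mv_algebra.unit_closed[OF assms]
      mv_algebra.neg_neg[OF assms] mv_algebra.neg_zero[OF assms] mv_algebra.oplus_unit[OF assms])
qed

section \<open>Order, lattice and monoid laws of an EMV-algebra\<close>

context emv_algebra
begin

abbreviation le (infix "\<sqsubseteq>" 50) where "x \<sqsubseteq> y \<equiv> emv_le M x y"
abbreviation add (infixl "\<oplus>" 65) where "x \<oplus> y \<equiv> oplus M x y"
abbreviation meet (infixl "\<sqinter>" 70) where "x \<sqinter> y \<equiv> emeet M x y"
abbreviation join (infixl "\<squnion>" 65) where "x \<squnion> y \<equiv> ejoin M x y"
abbreviation lam where "lam b x \<equiv> emv_lambda M (zero M) b x"
abbreviation seg where "seg b \<equiv> emv_interval M (zero M) b"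

lemma add_closed: "\<lbrakk>x \<in> carrier M; y \<in> carrier M\<rbrakk> \<Longrightarrow> x \<oplus> y \<in> carrier M"
  and zero_mem: "zero M \<in> carrier M"
  and add_assoc: "\<lbrakk>x \<in> carrier M; y \<in> carrier M; z \<in> carrier M\<rbrakk> \<Longrightarrow> x \<oplus> y \<oplus> z = x \<oplus> (y \<oplus> z)"
  and add_comm: "\<lbrakk>x \<in> carrier M; y \<in> carrier M\<rbrakk> \<Longrightarrow> x \<oplus> y = y \<oplus> x"
  and add_zero: "x \<in> carrier M \<Longrightarrow> x \<oplus> zero M = x"
proof -
  interpret C: comm_monoid "oplus_monoid M" by (rule comm_monoid)
  show "\<lbrakk>x \<in> carrier M; y \<in> carrier M\<rbrakk> \<Longrightarrow> x \<oplus> y \<in> carrier M" "zero M \<in> carrier M"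
    "\<lbrakk>x \<in> carrier M; y \<in> carrier M; z \<in> carrier M\<rbrakk> \<Longrightarrow> x \<oplus> y \<oplus> z = x \<oplus> (y \<oplus> z)"
    "\<lbrakk>x \<in> carrier M; y \<in> carrier M\<rbrakk> \<Longrightarrow> x \<oplus> y = y \<oplus> x"
    "x \<in> carrier M \<Longrightarrow> x \<oplus> zero M = x"
    using C.m_closed C.one_closed C.m_assoc C.m_comm C.r_one by auto
qed

lemma meet_idem: "x \<in> carrier M \<Longrightarrow> x \<sqinter> x = x"
  by (metis join_absorb meet_absorb meet_closed)

lemma le_refl: "x \<in> carrier M \<Longrightarrow> x \<sqsubseteq> x"
  by (simp add: emv_le_def meet_idem)

lemma le_antisym: "\<lbrakk>x \<in> carrier M; y \<in> carrier M; x \<sqsubseteq> y; y \<sqsubseteq> x\<rbrakk> \<Longrightarrow> x = y"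
  by (metis emv_le_def meet_comm)

lemma le_trans:
  "\<lbrakk>x \<in> carrier M; y \<in> carrier M; z \<in> carrier M; x \<sqsubseteq> y; y \<sqsubseteq> z\<rbrakk> \<Longrightarrow> x \<sqsubseteq> z"
  by (metis emv_le_def meet_assoc)

lemma meet_le1: "\<lbrakk>x \<in> carrier M; y \<in> carrier M\<rbrakk> \<Longrightarrow> x \<sqinter> y \<sqsubseteq> x"
  by (metis emv_le_def meet_assoc meet_comm meet_idem)

lemma meet_le2: "\<lbrakk>x \<in> carrier M; y \<in> carrier M\<rbrakk> \<Longrightarrow> x \<sqinter> y \<sqsubseteq> y"
  by (metis emv_le_def meet_assoc meet_idem)

lemma meet_greatest:
  "\<lbrakk>x \<in> carrier M; y \<in> carrier M; z \<in> carrier M; z \<sqsubseteq> x; z \<sqsubseteq> y\<rbrakk> \<Longrightarrow> z \<sqsubseteq> x \<sqinter> y"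
  by (metis emv_le_def meet_assoc)

lemma meet_mono:
  "\<lbrakk>x \<in> carrier M; y \<in> carrier M; z \<in> carrier M; x \<sqsubseteq> y\<rbrakk> \<Longrightarrow> x \<sqinter> z \<sqsubseteq> y \<sqinter> z"
  by (meson le_trans meet_closed meet_greatest meet_le1 meet_le2)

lemma le_iff_join: "\<lbrakk>x \<in> carrier M; y \<in> carrier M\<rbrakk> \<Longrightarrow> x \<sqsubseteq> y \<longleftrightarrow> x \<squnion> y = y"
  by (metis emv_le_def join_absorb join_comm meet_absorb meet_comm)

lemma join_ge1: "\<lbrakk>x \<in> carrier M; y \<in> carrier M\<rbrakk> \<Longrightarrow> x \<sqsubseteq> x \<squnion> y"
  by (simp add: emv_le_def meet_absorb)

lemma join_ge2: "\<lbrakk>x \<in> carrier M; y \<in> carrier M\<rbrakk> \<Longrightarrow> y \<sqsubseteq> x \<squnion> y"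
  by (metis join_ge1 join_comm)

lemma join_least:
  "\<lbrakk>x \<in> carrier M; y \<in> carrier M; z \<in> carrier M; x \<sqsubseteq> z; y \<sqsubseteq> z\<rbrakk> \<Longrightarrow> x \<squnion> y \<sqsubseteq> z"
  by (simp add: le_iff_join join_assoc join_closed)

lemma add_mono:
  assumes "x \<in> carrier M" "y \<in> carrier M" "u \<in> carrier M" "v \<in> carrier M" "x \<sqsubseteq> y" "u \<sqsubseteq> v"
  shows "x \<oplus> u \<sqsubseteq> y \<oplus> v"
  by (metis assms add_closed add_comm le_trans oplus_mono)

lemma le_add1: "\<lbrakk>x \<in> carrier M; y \<in> carrier M\<rbrakk> \<Longrightarrow> x \<sqsubseteq> x \<oplus> y"
  by (metis add_mono add_zero le_refl zero_least zero_mem)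

lemma le_add2: "\<lbrakk>x \<in> carrier M; y \<in> carrier M\<rbrakk> \<Longrightarrow> y \<sqsubseteq> x \<oplus> y"
  by (metis le_add1 add_comm)

lemma seg_iff: "x \<in> seg b \<longleftrightarrow> x \<in> carrier M \<and> x \<sqsubseteq> b"
  by (auto simp: emv_interval_def zero_least)

lemma idem_carrier: "b \<in> idempotents M \<Longrightarrow> b \<in> carrier M"
  and idem_add: "b \<in> idempotents M \<Longrightarrow> b \<oplus> b = b"
  by (simp_all add: idempotents_def)

lemma zero_idem: "zero M \<in> idempotents M"
  by (simp add: idempotents_def zero_mem add_zero)

lemma meet_seg: "\<lbrakk>x \<in> carrier M; b \<in> idempotents M\<rbrakk> \<Longrightarrow> x \<sqinter> b \<in> seg b"
  by (simp add: seg_iff idem_carrier meet_closed meet_le2)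

lemma idem_above2:
  assumes "x \<in> carrier M" "y \<in> carrier M"
  obtains d where "d \<in> idempotents M" "x \<sqsubseteq> d" "y \<sqsubseteq> d"
proof -
  obtain d where "d \<in> idempotents M" "x \<squnion> y \<sqsubseteq> d"
    using idempotent_above assms join_closed by blast
  with that show ?thesis
    by (meson assms idem_carrier join_closed join_ge1 join_ge2 le_trans)
qed

lemma idem_above3:
  assumes "x \<in> carrier M" "y \<in> carrier M" "z \<in> carrier M"
  obtains d where "d \<in> idempotents M" "x \<sqsubseteq> d" "y \<sqsubseteq> d" "z \<sqsubseteq> d"
proof -
  obtain d where "d \<in> idempotents M" "x \<squnion> y \<sqsubseteq> d" "z \<sqsubseteq> d"
    using idem_above2 assms join_closed by metis
  with that show ?thesis
    by (meson assms idem_carrier join_closed join_ge1 join_ge2 le_trans)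
qed

lemma seg_mv: "b \<in> idempotents M \<Longrightarrow> mv_algebra (interval_mv M (zero M) b)"
  by (simp add: interval_mv_algebra zero_idem zero_least idem_carrier)

text \<open>Antisymmetry makes minima unique, so the description in \<open>emv_lambda\<close>
  denotes the minimum supplied by \<open>complement_exists\<close>.\<close>

lemma lam_is_min:
  assumes "b \<in> idempotents M" "x \<in> seg b"
  shows "is_emv_min M (emv_complements M (zero M) b x) (lam b x)"
proof -
  obtain z where z: "is_emv_min M (emv_complements M (zero M) b x) z"
    using complement_exists[OF zero_idem assms(1) zero_least assms(2)] idem_carrier assms(1) by blast
  show ?thesis unfolding emv_lambda_def
    by (rule theI[where a = z], rule z)
      (use z in \<open>auto simp: is_emv_min_def emv_complements_def seg_iff intro: le_antisym\<close>)
qed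

section \<open>The MV-algebra below a fixed idempotent\<close>

context
  fixes b assumes b: "b \<in> idempotents M"
begin

lemma lam_seg: "x \<in> seg b \<Longrightarrow> lam b x \<in> seg b"
  and add_lam: "x \<in> seg b \<Longrightarrow> x \<oplus> lam b x = b"
  and lam_le: "\<lbrakk>x \<in> seg b; z \<in> seg b; x \<oplus> z = b\<rbrakk> \<Longrightarrow> lam b x \<sqsubseteq> z"
  using lam_is_min[OF b, of x] by (auto simp: is_emv_min_def emv_complements_def)

lemma add_seg: "\<lbrakk>x \<in> seg b; y \<in> seg b\<rbrakk> \<Longrightarrow> x \<oplus> y \<in> seg b"
  using add_mono[of x b y b] b by (simp add: seg_iff add_closed idem_carrier idem_add)

lemma lam_lam: "x \<in> seg b \<Longrightarrow> lam b (lam b x) = x"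
  and lam_top: "lam b b = zero M"
  and lam_lukasiewicz: "\<lbrakk>x \<in> seg b; y \<in> seg b\<rbrakk> \<Longrightarrow>
    lam b (lam b x \<oplus> y) \<oplus> y = lam b (lam b y \<oplus> x) \<oplus> x"
  using mv_algebra.neg_neg[OF seg_mv[OF b], of x] mv_algebra.neg_unit[OF seg_mv[OF b]]
    mv_algebra.lukasiewicz[OF seg_mv[OF b], of x y]
  by (simp_all add: interval_mv_def)

text \<open>Forwards, add \<open>lam b x\<close> to both sides of the inequality. Backwards,
  \<open>y\<close> is a complement of \<open>lam b x\<close>, and the least such complement is
  \<open>lam b (lam b x) = x\<close>.\<close>

lemma le_iff_lam:
  assumes "x \<in> seg b" "y \<in> seg b"
  shows "x \<sqsubseteq> y \<longleftrightarrow> lam b x \<oplus> y = b"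
proof
  assume "x \<sqsubseteq> y"
  then have "b \<sqsubseteq> lam b x \<oplus> y"
    using assms add_lam[OF assms(1)] lam_seg[OF assms(1)] add_mono[of x y "lam b x" "lam b x"]
    by (metis add_comm le_refl seg_iff)
  then show "lam b x \<oplus> y = b"
    using add_seg[OF lam_seg[OF assms(1)] assms(2)] le_antisym idem_carrier[OF b]
    by (simp add: seg_iff)
next
  assume "lam b x \<oplus> y = b"
  then show "x \<sqsubseteq> y"
    using lam_le[OF lam_seg[OF assms(1)] assms(2)] lam_lam[OF assms(1)] by simp
qed

text \<open>By \<open>le_iff_lam\<close> and double negation, both inequalities express the same
  equation \<open>lam b x \<oplus> y = b\<close>.\<close>

lemma lam_antimono:
  assumes "x \<in> seg b" "y \<in> seg b" "x \<sqsubseteq> y"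
  shows "lam b y \<sqsubseteq> lam b x"
  using assms le_iff_lam[OF assms(1,2)] le_iff_lam[OF lam_seg lam_seg, of y x] lam_lam lam_seg
  by (metis add_comm seg_iff)

text \<open>The element \<open>lam b (lam b t \<oplus> z)\<close> is the truncated difference of
  \<open>t\<close> and \<open>z\<close>. Both inequalities unfold to
  \<open>lam b t \<oplus> z \<oplus> x = b\<close>, which makes subtracting \<open>z\<close> left
  adjoint to adding \<open>z\<close>.\<close>

lemma le_add_iff:
  assumes "t \<in> seg b" "z \<in> seg b" "x \<in> seg b"
  shows "t \<sqsubseteq> z \<oplus> x \<longleftrightarrow> lam b (lam b t \<oplus> z) \<sqsubseteq> x"
proof -
  have "t \<sqsubseteq> z \<oplus> x \<longleftrightarrow> lam b t \<oplus> z \<oplus> x = b"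
    using assms lam_seg add_seg le_iff_lam by (metis add_assoc seg_iff)
  also have "\<dots> \<longleftrightarrow> lam b (lam b t \<oplus> z) \<sqsubseteq> x"
    using assms lam_seg add_seg le_iff_lam lam_lam by metis
  finally show ?thesis .
qed

text \<open>By \<open>le_add_iff\<close>, adding \<open>z\<close> is a right adjoint on the
  interval, and right adjoints preserve meets.\<close>

lemma add_meet_seg:
  assumes "x \<in> seg b" "y \<in> seg b" "z \<in> seg b"
  shows "z \<oplus> x \<sqinter> y = (z \<oplus> x) \<sqinter> (z \<oplus> y)"
proof -
  let ?t = "(z \<oplus> x) \<sqinter> (z \<oplus> y)"
  have c: "x \<in> carrier M" "y \<in> carrier M" "z \<in> carrier M" "x \<sqinter> y \<in> carrier M"
    "z \<oplus> x \<in> carrier M" "z \<oplus> y \<in> carrier M"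
    using assms by (auto simp: seg_iff add_closed meet_closed)
  have m: "x \<sqinter> y \<in> seg b" "?t \<in> seg b"
    using assms add_seg[OF assms(3,1)] c meet_closed meet_le1 le_trans idem_carrier[OF b]
    unfolding seg_iff by meson+
  have r: "lam b (lam b ?t \<oplus> z) \<in> seg b"
    using m assms lam_seg add_seg by blast
  have "?t \<sqsubseteq> z \<oplus> x" "?t \<sqsubseteq> z \<oplus> y"
    using c by (auto intro: meet_le1 meet_le2)
  then have "lam b (lam b ?t \<oplus> z) \<sqsubseteq> x \<sqinter> y"
    using le_add_iff[OF m(2) assms(3)] assms c r meet_greatest by (simp add: seg_iff)
  then have "?t \<sqsubseteq> z \<oplus> x \<sqinter> y"
    using le_add_iff[OF m(2) assms(3) m(1)] by simp
  moreover have "z \<oplus> x \<sqinter> y \<sqsubseteq> ?t"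
    using c by (auto intro!: meet_greatest add_mono add_closed intro: le_refl meet_le1 meet_le2)
  ultimately show ?thesis
    using c by (auto intro: le_antisym add_closed meet_closed)
qed

text \<open>Write \<open>s\<close> for the meet. Distributing gives \<open>e \<oplus> s = (e
  \<oplus> e) \<sqinter> (e \<oplus> lam b e) = e\<close>: adding \<open>s\<close> does not change
  \<open>e\<close>. The Lukasiewicz law for \<open>lam b s\<close> and \<open>e\<close> then forces
  \<open>lam b s = b\<close>, hence \<open>s\<close> is zero.\<close>

lemma idem_meet_lam:
  assumes "e \<in> idempotents M" "e \<in> seg b"
  shows "e \<sqinter> lam b e = zero M"
proof -
  let ?s = "e \<sqinter> lam b e"
  have c: "e \<in> carrier M" "lam b e \<in> seg b" "lam b e \<in> carrier M" "?s \<in> carrier M" "b \<in> carrier M"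
    using assms lam_seg[OF assms(2)] b by (auto simp: seg_iff meet_closed idem_carrier)
  then have s: "?s \<in> seg b"
    using assms(2) meet_le1 le_trans unfolding seg_iff by meson
  have ls: "lam b ?s \<in> seg b"
    by (rule lam_seg[OF s])
  have "e \<oplus> ?s = (e \<oplus> e) \<sqinter> (e \<oplus> lam b e)"
    by (rule add_meet_seg) (use assms c in auto)
  also have "\<dots> = e"
    using assms by (simp add: idem_add add_lam seg_iff emv_le_def)
  finally have es: "?s \<oplus> e = e"
    using c by (simp add: add_comm)
  have "e \<sqsubseteq> lam b ?s"
    using lam_antimono[OF s c(2)] c lam_lam[OF assms(2)] meet_le2 by simp
  \<comment> \<open>Since \<open>e \<sqsubseteq> lam b ?s\<close>, the inner sum is
    \<open>b\<close>, so the added first summand is \<open>lam b b\<close>, which is zero. This puts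
    \<open>lam b ?s\<close> into the shape of one side of the Lukasiewicz law.\<close>
  then have "lam b ?s = lam b (lam b e \<oplus> lam b ?s) \<oplus> lam b ?s"
    using le_iff_lam[OF assms(2) ls] lam_top ls
    by (simp add: add_comm[OF zero_mem] add_zero seg_iff)
  also have "\<dots> = lam b (?s \<oplus> e) \<oplus> e"
    using lam_lukasiewicz[OF ls assms(2)] lam_lam[OF s] by simp
  also have "\<dots> = b"
    using es add_lam[OF assms(2)] c add_comm by simp
  finally show ?thesis
    using lam_lam[OF s] lam_top by simp
qed

text \<open>The MV term is shown to be the least upper bound in the order of \<open>M\<close>. The
  Lukasiewicz law makes it symmetric, hence above both arguments. It is also monotone in
  \<open>x\<close>, and with \<open>x \<squnion> y\<close> in place of \<open>x\<close> it takes the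
  value \<open>x \<squnion> y\<close>, so it lies below that join.\<close>

lemma mv_join_seg:
  assumes "x \<in> seg b" "y \<in> seg b"
  shows "mv_join (interval_mv M (zero M) b) x y = x \<squnion> y"
proof -
  let ?j = "lam b (lam b x \<oplus> y) \<oplus> y"
  let ?u = "x \<squnion> y"
  have c: "x \<in> carrier M" "y \<in> carrier M" "?u \<in> carrier M"
    using assms by (auto simp: seg_iff join_closed)
  have u: "?u \<in> seg b" "x \<sqsubseteq> ?u" "y \<sqsubseteq> ?u"
    using assms b c by (auto simp: seg_iff idem_carrier intro: join_least join_ge1 join_ge2)
  have l: "lam b x \<in> seg b" "lam b ?u \<in> seg b" "lam b (lam b x \<oplus> y) \<in> seg b"
    "lam b (lam b ?u \<oplus> y) \<in> seg b" "lam b (lam b y \<oplus> x) \<in> seg b" "lam b x \<oplus> y \<in> seg b"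
    "lam b ?u \<oplus> y \<in> seg b"
    using assms u by (auto intro!: lam_seg add_seg)
  note lc = l[unfolded seg_iff, THEN conjunct1]
  have j: "?j \<in> carrier M"
    using lc c by (simp add: add_closed)
  have "y \<sqsubseteq> ?j"
    using lc c by (simp add: le_add2)
  moreover have "x \<sqsubseteq> ?j"
    using lam_lukasiewicz[OF assms] lc c by (simp add: le_add2)
  ultimately have "?u \<sqsubseteq> ?j"
    using c j join_least by blast
  moreover have "?j \<sqsubseteq> ?u"
  proof -
    have "lam b ?u \<oplus> y \<sqsubseteq> lam b x \<oplus> y"
      using assms u lam_antimono lc c by (simp add: oplus_mono)
    then have "?j \<sqsubseteq> lam b (lam b ?u \<oplus> y) \<oplus> y"
      using lam_antimono l lc c by (simp add: oplus_mono)
    also have "lam b (lam b ?u \<oplus> y) \<oplus> y = lam b (lam b y \<oplus> ?u) \<oplus> ?u"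
      by (rule lam_lukasiewicz[OF u(1) assms(2)])
    \<comment> \<open>As \<open>y\<close> lies below \<open>?u\<close>, the inner sum is
      \<open>b\<close> and its negation vanishes.\<close>
    also have "\<dots> = ?u"
      using le_iff_lam[OF assms(2) u(1)] u(3) lam_top c
      by (simp add: add_comm[OF zero_mem] add_zero)
    finally show ?thesis .
  qed
  ultimately have "?j = ?u"
    using c j by (simp add: le_antisym)
  then show ?thesis
    by (simp add: mv_join_def interval_mv_def)
qed

text \<open>The map \<open>lam b\<close> is an order-reversing involution of the interval, so it
  exchanges joins and meets.\<close>

lemma mv_meet_seg:
  assumes "x \<in> seg b" "y \<in> seg b"
  shows "mv_meet (interval_mv M (zero M) b) x y = x \<sqinter> y"
proof -
  let ?j = "lam b x \<squnion> lam b y"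
  have l: "lam b x \<in> seg b" "lam b y \<in> seg b"
    using assms lam_seg by auto
  have c: "x \<in> carrier M" "y \<in> carrier M" "b \<in> carrier M" "x \<sqinter> y \<in> carrier M"
    "lam b x \<in> carrier M" "lam b y \<in> carrier M" "?j \<in> carrier M"
    using assms l b by (auto simp: seg_iff idem_carrier join_closed meet_closed)
  have j: "?j \<in> seg b"
    using l c by (auto simp: seg_iff intro: join_least)
  have lj: "lam b ?j \<in> seg b"
    by (rule lam_seg[OF j])
  have m: "x \<sqinter> y \<in> seg b"
    using assms c meet_le1 le_trans unfolding seg_iff by meson
  have "lam b ?j \<sqsubseteq> x" "lam b ?j \<sqsubseteq> y"
    using lam_antimono[OF l(1) j] lam_antimono[OF l(2) j] c lam_lam assms
    by (auto simp: join_ge1 join_ge2)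
  then have 1: "lam b ?j \<sqsubseteq> x \<sqinter> y"
    using lj c by (simp add: meet_greatest seg_iff)
  have "?j \<sqsubseteq> lam b (x \<sqinter> y)"
    using lam_antimono[OF m assms(1)] lam_antimono[OF m assms(2)] c lam_seg[OF m]
    by (intro join_least) (auto simp: meet_le1 meet_le2 seg_iff)
  then have "x \<sqinter> y \<sqsubseteq> lam b ?j"
    using lam_antimono[OF j lam_seg[OF m]] lam_lam[OF m] by simp
  then have "lam b ?j = x \<sqinter> y"
    using 1 lj c by (simp add: le_antisym seg_iff)
  then show ?thesis
    using mv_join_seg[OF l] by (simp add: mv_meet_def interval_mv_def)
qed

end

section \<open>Meeting with an idempotent\<close>

lemma add_meet_idem:
  assumes "x \<in> carrier M" "y \<in> carrier M" "b \<in> idempotents M"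
  shows "(x \<oplus> y) \<sqinter> b = x \<sqinter> b \<oplus> y \<sqinter> b"
proof -
  note bc = idem_carrier[OF assms(3)]
  \<comment> \<open>\<open>add_meet_seg\<close> works only inside one interval, so \<open>x\<close>,
    \<open>y\<close> and \<open>b\<close> are first placed in a common one.\<close>
  obtain d where d: "d \<in> idempotents M" "x \<sqsubseteq> d" "y \<sqsubseteq> d" "b \<sqsubseteq> d"
    using idem_above3 assms bc by metis
  have s: "x \<in> seg d" "y \<in> seg d" "b \<in> seg d"
    using d assms bc by (auto simp: seg_iff)
  have xb: "x \<sqinter> b \<in> seg d"
    using s d(1) meet_le1 le_trans meet_closed idem_carrier unfolding seg_iff by meson
  let ?t = "(x \<oplus> y) \<sqinter> b"
  have t: "?t \<in> carrier M" "?t \<sqsubseteq> x \<oplus> y" "?t \<sqsubseteq> b"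
    using assms bc by (auto simp: add_closed meet_closed meet_le1 meet_le2)
  have mc: "x \<sqinter> b \<in> carrier M" "y \<sqinter> b \<in> carrier M"
    using assms bc by (auto simp: meet_closed)
  have 1: "z \<sqinter> b \<oplus> w = (w \<oplus> z) \<sqinter> (w \<oplus> b)" if "z \<in> seg d" "w \<in> seg d" for z w
    using add_meet_seg[OF d(1) that(1) s(3) that(2)] that bc
    by (simp add: add_comm meet_closed seg_iff)
  \<comment> \<open>Distributing both meets yields four sums. Those with \<open>b\<close> as a
    summand lie above \<open>b\<close>, hence above \<open>?t\<close>; only
    \<open>x \<oplus> y\<close> needs the other bound on \<open>?t\<close>.\<close>
  have le_b: "?t \<sqsubseteq> w \<oplus> b" if "w \<in> carrier M" for w
    using le_trans[OF t(1) bc add_closed[OF that bc] t(3)] le_add2[OF that bc] by simp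
  have "?t \<sqsubseteq> x \<sqinter> b \<oplus> y"
    using 1[OF s(1,2)] t le_b[of y] assms bc by (simp add: meet_greatest add_closed add_comm)
  moreover have "?t \<sqsubseteq> x \<sqinter> b \<oplus> b"
    using le_b mc by simp
  ultimately have "?t \<sqsubseteq> x \<sqinter> b \<oplus> y \<sqinter> b"
    using add_meet_seg[OF d(1) s(2,3) xb] assms bc mc t by (simp add: meet_greatest add_closed)
  moreover have "x \<sqinter> b \<oplus> y \<sqinter> b \<sqsubseteq> ?t"
  proof (rule meet_greatest)
    \<comment> \<open>Idempotency of \<open>b\<close> enters here: it makes the interval below
      \<open>b\<close> closed under addition.\<close>
    show "x \<sqinter> b \<oplus> y \<sqinter> b \<sqsubseteq> b"
      using add_seg[OF assms(3) meet_seg meet_seg] assms by (simp add: seg_iff)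
  qed (use assms bc mc in \<open>auto intro!: add_mono simp: meet_le1 add_closed\<close>)
  ultimately show ?thesis
    using t mc by (simp add: le_antisym add_closed)
qed

lemma join_meet_distrib:
  "\<lbrakk>x \<in> carrier M; y \<in> carrier M; b \<in> carrier M\<rbrakk> \<Longrightarrow> (x \<squnion> y) \<sqinter> b = x \<sqinter> b \<squnion> y \<sqinter> b"
  by (metis distrib join_closed meet_comm)

lemma meet_meet_distrib:
  "\<lbrakk>x \<in> carrier M; y \<in> carrier M; b \<in> carrier M\<rbrakk> \<Longrightarrow> x \<sqinter> y \<sqinter> b = (x \<sqinter> b) \<sqinter> (y \<sqinter> b)"
  by (metis meet_assoc meet_closed meet_comm meet_idem)

text \<open>Meeting with \<open>c\<close> preserves sums, so it carries
  \<open>b \<oplus> b = b\<close> to the same equation for the meet.\<close>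

lemma idem_meet: "\<lbrakk>b \<in> idempotents M; c \<in> idempotents M\<rbrakk> \<Longrightarrow> b \<sqinter> c \<in> idempotents M"
  using add_meet_idem[of b b c] by (simp add: idempotents_def meet_closed)

text \<open>Minimality of \<open>lam c x\<close> passes to \<open>[0, b]\<close>: with \<open>e = c \<and> b\<close>, any \<open>w\<close> as below makes
  \<open>w \<oplus> lam c e\<close> a complement of \<open>x\<close> in \<open>[0, c]\<close>, and meeting with \<open>b\<close> removes \<open>lam c e\<close>.\<close>

lemma lam_meet_le:
  assumes c: "c \<in> idempotents M" and b: "b \<in> idempotents M" and x: "x \<in> seg c"
    and w: "w \<in> carrier M" "w \<sqsubseteq> c \<sqinter> b" and eq: "x \<sqinter> b \<oplus> w = c \<sqinter> b"
  shows "lam c x \<sqinter> b \<sqsubseteq> w"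
proof -
  let ?e = "c \<sqinter> b"
  let ?u = "w \<oplus> lam c ?e"
  note bc = idem_carrier[OF b] and cc = idem_carrier[OF c]
  have xc: "x \<in> carrier M" using x by (simp add: seg_iff)
  have e: "?e \<in> idempotents M" "?e \<in> carrier M" "?e \<in> seg c"
    using idem_meet[OF c b] bc cc by (auto simp: seg_iff meet_closed meet_le1)
  have l: "lam c ?e \<in> seg c" "lam c ?e \<in> carrier M"
    using lam_seg[OF c e(3)] by (auto simp: seg_iff)
  have lx: "lam c x \<in> seg c" "lam c x \<in> carrier M"
    using lam_seg[OF c x] by (auto simp: seg_iff)
  have ws: "w \<in> seg c"
    using le_trans[OF w(1) e(2) cc w(2)] bc cc w(1) by (simp add: seg_iff meet_le1)
  have u: "?u \<in> seg c" "?u \<in> carrier M"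
    using add_seg[OF c ws l(1)] by (auto simp: seg_iff)
  have xu: "x \<oplus> ?u \<in> seg c"
    by (rule add_seg[OF c x u(1)])
  have "x \<sqinter> b \<oplus> w \<oplus> lam c ?e \<sqsubseteq> x \<oplus> w \<oplus> lam c ?e"
    using xc bc w l by (intro oplus_mono) (auto simp: meet_closed add_closed meet_le1)
  then have "c \<sqsubseteq> x \<oplus> ?u"
    using eq add_lam[OF c e(3)] add_assoc[OF xc w(1) l(2)] by simp
  then have "x \<oplus> ?u = c"
    using xu cc le_antisym by (simp add: seg_iff)
  then have "lam c x \<sqsubseteq> ?u"
    by (rule lam_le[OF c x u(1)])
  then have "lam c x \<sqinter> b \<sqsubseteq> ?u \<sqinter> b"
    by (rule meet_mono[OF lx(2) u(2) bc])
  also have "?u \<sqinter> b = w \<sqinter> b \<oplus> lam c ?e \<sqinter> b"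
    by (rule add_meet_idem[OF w(1) l(2) b])
  also have "w \<sqinter> b = w"
    using le_trans[OF w(1) e(2) bc w(2)] meet_le2[OF cc bc] by (simp add: emv_le_def)
  \<comment> \<open>Since \<open>lam c ?e\<close> lies below \<open>c\<close>, meeting it with
    \<open>b\<close> equals meeting it with \<open>c \<sqinter> b\<close>, and there
    \<open>idem_meet_lam\<close> applies.\<close>
  also have "lam c ?e \<sqinter> b = lam c ?e \<sqinter> ?e"
    using l bc cc by (metis emv_le_def meet_assoc seg_iff)
  also have "\<dots> = zero M"
    using idem_meet_lam[OF c e(1,3)] meet_comm[OF l(2) e(2)] by simp
  finally show ?thesis
    using w by (simp add: add_zero)
qed

section \<open>The embedding into the product of all intervals\<close>

text \<open>Both the indices and the coordinates are elements of \<open>M\<close>, which explains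
  the type \<open>'a \<Rightarrow> 'a\<close>.\<close>

definition seg_prod :: "('a \<Rightarrow> 'a) mv_struct" where
  "seg_prod = mv_prod (idempotents M) (interval_mv M (zero M))"

definition trace :: "'a \<Rightarrow> 'a \<Rightarrow> 'a" where
  "trace x = (\<lambda>b\<in>idempotents M. x \<sqinter> b)"

lemma mv_algebra_seg_prod: "mv_algebra seg_prod"
  unfolding seg_prod_def by (intro mv_algebra_prod seg_mv)

lemma carrier_seg_prod: "carrier seg_prod = (\<Pi>\<^sub>E b\<in>idempotents M. seg b)"
  and oplus_seg_prod: "oplus seg_prod g h = (\<lambda>b\<in>idempotents M. g b \<oplus> h b)"
  and zero_seg_prod: "zero seg_prod = (\<lambda>b\<in>idempotents M. zero M)"
  by (simp_all add: seg_prod_def mv_prod_simps interval_mv_def)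

lemma join_seg_prod:
  "\<lbrakk>g \<in> carrier seg_prod; h \<in> carrier seg_prod\<rbrakk> \<Longrightarrow>
    mv_join seg_prod g h = (\<lambda>b\<in>idempotents M. g b \<squnion> h b)"
  unfolding carrier_seg_prod unfolding seg_prod_def
  by (auto simp: mv_join_prod PiE_iff mv_join_seg intro!: restrict_ext)

lemma meet_seg_prod:
  "\<lbrakk>g \<in> carrier seg_prod; h \<in> carrier seg_prod\<rbrakk> \<Longrightarrow>
    mv_meet seg_prod g h = (\<lambda>b\<in>idempotents M. g b \<sqinter> h b)"
  unfolding carrier_seg_prod unfolding seg_prod_def
  by (auto simp: mv_meet_prod PiE_iff mv_meet_seg intro!: restrict_ext)

lemma le_seg_prod:
  assumes "g \<in> carrier seg_prod" "h \<in> carrier seg_prod"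
  shows "emv_le (mv_to_emv seg_prod) g h \<longleftrightarrow> (\<forall>b\<in>idempotents M. g b \<sqsubseteq> h b)"
proof -
  have "emv_le (mv_to_emv seg_prod) g h \<longleftrightarrow> (\<lambda>b\<in>idempotents M. g b \<sqinter> h b) = g"
    by (simp add: emv_le_def mv_to_emv_def meet_seg_prod assms)
  also have "\<dots> \<longleftrightarrow> (\<forall>b\<in>idempotents M. g b \<sqsubseteq> h b)"
    using assms(1) by (auto simp: emv_le_def carrier_seg_prod PiE_iff extensional_def fun_eq_iff
        restrict_def split: if_splits)
  finally show ?thesis .
qed

lemma trace_closed: "x \<in> carrier M \<Longrightarrow> trace x \<in> carrier seg_prod"
  by (auto simp: trace_def carrier_seg_prod meet_seg)

lemma trace_join:
  "\<lbrakk>x \<in> carrier M; y \<in> carrier M\<rbrakk> \<Longrightarrow> trace (x \<squnion> y) = mv_join seg_prod (trace x) (trace y)"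
  by (simp add: join_seg_prod trace_closed)
    (auto simp: trace_def join_meet_distrib idem_carrier intro!: restrict_ext)

lemma trace_meet:
  "\<lbrakk>x \<in> carrier M; y \<in> carrier M\<rbrakk> \<Longrightarrow> trace (x \<sqinter> y) = mv_meet seg_prod (trace x) (trace y)"
  by (simp add: meet_seg_prod trace_closed)
    (auto simp: trace_def meet_meet_distrib idem_carrier intro!: restrict_ext)

lemma trace_add:
  "\<lbrakk>x \<in> carrier M; y \<in> carrier M\<rbrakk> \<Longrightarrow> trace (x \<oplus> y) = oplus seg_prod (trace x) (trace y)"
  by (auto simp: oplus_seg_prod trace_def add_meet_idem intro!: restrict_ext)

lemma trace_zero: "trace (zero M) = zero seg_prod"
  using zero_least by (auto simp: zero_seg_prod trace_def idem_carrier emv_le_def intro!: restrict_ext)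

text \<open>The right side is the least complement of \<open>trace x\<close> below
  \<open>trace c\<close> in the whole product. Additivity makes \<open>trace (lam c x)\<close> such
  a complement, and \<open>lam_meet_le\<close> compares it with any other one coordinate by
  coordinate.\<close>

lemma trace_lam:
  assumes c: "c \<in> idempotents M" and x: "x \<in> seg c"
  shows "trace (lam c x) = emv_lambda (mv_to_emv seg_prod) (zero seg_prod) (trace c) (trace x)"
proof -
  let ?N = "mv_to_emv seg_prod"
  let ?S = "emv_complements ?N (zero seg_prod) (trace c) (trace x)"
  note cc = idem_carrier[OF c]
  have xc: "x \<in> carrier M" using x by (simp add: seg_iff)
  have l: "lam c x \<in> carrier M" "lam c x \<sqsubseteq> c"
    using lam_seg[OF c x] by (auto simp: seg_iff)
  note z = mv_algebra.zero_closed[OF mv_algebra_seg_prod]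
  note t = trace_closed[OF cc] trace_closed[OF l(1)]
  \<comment> \<open>The order of the product is pointwise and the lower bound zero is automatic, so
    membership reduces to coordinatewise bounds and one equation.\<close>
  have S: "w \<in> ?S \<longleftrightarrow> w \<in> carrier seg_prod \<and> (\<forall>b\<in>idempotents M. w b \<sqsubseteq> c \<sqinter> b) \<and>
      oplus seg_prod (trace x) w = trace c" for w
  proof -
    have "emv_le ?N (zero seg_prod) w" if "w \<in> carrier seg_prod"
      using that z by (auto simp: le_seg_prod zero_seg_prod carrier_seg_prod PiE_iff seg_iff zero_least)
    moreover have "emv_le ?N w (trace c) \<longleftrightarrow> (\<forall>b\<in>idempotents M. w b \<sqsubseteq> c \<sqinter> b)"
      if "w \<in> carrier seg_prod"
      using that t by (auto simp: le_seg_prod trace_def)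
    ultimately show ?thesis
      by (auto simp: emv_complements_def emv_interval_def mv_to_emv_def)
  qed
  have min: "is_emv_min ?N ?S (trace (lam c x))"
    unfolding is_emv_min_def
  proof
    have "oplus seg_prod (trace x) (trace (lam c x)) = trace c"
      using trace_add[OF xc l(1)] add_lam[OF c x] by simp
    moreover have "trace (lam c x) b \<sqsubseteq> c \<sqinter> b" if "b \<in> idempotents M" for b
      using that l cc meet_mono by (simp add: trace_def idem_carrier)
    ultimately show "trace (lam c x) \<in> ?S"
      using t by (simp add: S)
    show "\<forall>w\<in>?S. emv_le ?N (trace (lam c x)) w"
    proof
      fix w assume "w \<in> ?S"
      then have w: "w \<in> carrier seg_prod" "oplus seg_prod (trace x) w = trace c"
        and wle: "\<And>b. b \<in> idempotents M \<Longrightarrow> w b \<sqsubseteq> c \<sqinter> b"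
        by (auto simp: S)
      have "lam c x \<sqinter> b \<sqsubseteq> w b" if b: "b \<in> idempotents M" for b
      proof (rule lam_meet_le[OF c b x _ wle[OF b]])
        show "w b \<in> carrier M"
          using w(1) b by (auto simp: carrier_seg_prod PiE_iff seg_iff)
        show "x \<sqinter> b \<oplus> w b = c \<sqinter> b"
          using fun_cong[OF w(2), of b] b by (simp add: oplus_seg_prod trace_def)
      qed
      then show "emv_le ?N (trace (lam c x)) w"
        using t w by (simp add: le_seg_prod trace_def)
    qed
  qed
  \<comment> \<open>\<open>emv_lambda\<close> is a definite description, so the minimum must also be
    unique; antisymmetry is obtained from that of \<open>M\<close> in each coordinate.\<close>
  have "w = trace (lam c x)" if "is_emv_min ?N ?S w" for w
  proof -
    have "emv_le ?N w (trace (lam c x))" "emv_le ?N (trace (lam c x)) w" "w \<in> carrier seg_prod"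
      using min that by (auto simp: is_emv_min_def S)
    then show ?thesis
      using t(2) by (intro PiE_ext[of w "idempotents M" seg])
        (auto simp: le_seg_prod carrier_seg_prod PiE_iff seg_iff intro: le_antisym)
  qed
  then show ?thesis
    unfolding emv_lambda_def[of ?N] using min by (intro the_equality[symmetric])
qed

lemma trace_hom: "trace \<in> emv_hom M (mv_to_emv seg_prod)"
  unfolding emv_hom_def
  using trace_closed trace_join trace_meet trace_add trace_zero trace_lam
  by (simp add: mv_to_emv_def)

lemma trace_inj: "inj_on trace (carrier M)"
proof (rule inj_onI)
  fix x y assume xy: "x \<in> carrier M" "y \<in> carrier M" and eq: "trace x = trace y"
  \<comment> \<open>The coordinate at \<open>d\<close> returns \<open>x\<close> and \<open>y\<close>
    unchanged, so this single coordinate separates them.\<close>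
  obtain d where d: "d \<in> idempotents M" "x \<sqsubseteq> d" "y \<sqsubseteq> d"
    using idem_above2 xy by metis
  then show "x = y"
    using fun_cong[OF eq, of d] by (simp add: trace_def emv_le_def)
qed

end

theorem theorem5p20:
  fixes M :: "'a emv_struct"
  assumes "emv_algebra M"
  shows "\<exists>(N :: ('a \<Rightarrow> 'a) mv_struct) f.
    mv_algebra N \<and> f \<in> emv_hom M (mv_to_emv N) \<and> inj_on f (carrier M)"
proof -
  interpret emv_algebra M by fact
  show ?thesis
    using mv_algebra_seg_prod trace_hom trace_inj by blast
qed

end
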